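(* Let $Y$ be a separable Hilbert space with norm $\|\cdot\|_Y$, let $y\in Y$ and let $A:X\to Y$ be a bounded linear operator. Let $\mathcal I=\{I_k\}_{k\in\mathcal N}$ be a family of bounded closed intervals of $\mathbb R$ such that there exists $\omega>0$ with $[-\omega,\omega]\subset I_k$ for all $k\in\mathcal N$. Then the function $$f:X\to\mathbb R\cup\{+\infty\},\quad f(x)=\|x\|_{1,\mathcal I}+\tfrac12\|Ax-y\|_Y^2$$ satisfies the finite uniform conditioning property of order $2$.
   Context: $X$ is a real separable Hilbert space with inner product $\langle\cdot,\cdot\rangle$; $\mathcal N\subset\mathbb N$ and $(e_k)_{k\in\mathcal N}$ is an orthonormal basis of $X$; for $x\in X$, $x_k=\langle x,e_k\rangle$. $\|x\|_{1,\mathcal I}=\sum_{k\in\mathcal N}\sigma_{I_k}(x_k)$, where $\sigma_I(t)=\sup_{s\in I}st$ is the support function of $I$. $\operatorname{supp}(x)=\{k\in\mathcal N:x_k\neq0\}$, $X_J=\{x\in X:\operatorname{supp}(x)\subset J\}$, $\mathbb B_X(x,\delta)$ is the closed ball of center $x$ and radius $\delta$, and $S_\phi(r)=\{x\in X:\phi(x)-\inf\phi<r\}$. For $p\in[2,+\infty[$ and $\Omega\subset X$, a proper convex lower semicontinuous function $\phi:X\to\mathbb R\cup\{+\infty\}$ is $p$-conditioned on $\Omega$ if there exists $\gamma>0$ such that $\frac{\gamma}{p}\operatorname{dist}(x,\operatorname{argmin}\phi)^p\le\phi(x)-\inf\phi$ for all $x\in\Omega$. It satisfies the finite uniform conditioning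 property of order $p$ if, for every finite $J\subset\mathcal N$, every $\bar x\in\operatorname{argmin}\phi$ and all $(\delta,r)\in\left]0,+\infty\right[^2$, $\phi$ is $p$-conditioned on $X_J\cap\mathbb B_X(\bar x,\delta)\cap S_\phi(r)$. *)

theory Defs
  imports "HOL-Analysis.Analysis"
begin

text \<open>An orthonormal basis is a Hilbert basis: an orthonormal family whose closed linear span is
  the whole space. The index set may be finite, infinite or empty.\<close>

definition orthonormal_basis :: "nat set \<Rightarrow> (nat \<Rightarrow> 'a::real_inner) \<Rightarrow> bool" where
  "orthonormal_basis N e \<longleftrightarrow>
     (\<forall>j\<in>N. \<forall>k\<in>N. e j \<bullet> e k = (if j = k then 1 else 0)) \<and>
     closure (span (e ` N)) = UNIV"

definition supp :: "nat set \<Rightarrow> (nat \<Rightarrow> 'a::real_inner) \<Rightarrow> 'a \<Rightarrow> nat set" where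
  "supp N e x = {k \<in> N. x \<bullet> e k \<noteq> 0}"

definition supp_subspace :: "nat set \<Rightarrow> (nat \<Rightarrow> 'a::real_inner) \<Rightarrow> nat set \<Rightarrow> 'a set" where
  "supp_subspace N e J = {x. supp N e x \<subseteq> J}"

definition support_fun :: "real set \<Rightarrow> real \<Rightarrow> ereal" where
  "support_fun S t = (SUP s\<in>S. ereal (s * t))"

text \<open>When every \<open>I k\<close> contains \<open>0\<close>, the terms below are nonnegative, so the sum always exists in
  \<open>[0, \<infinity>]\<close> (it is the supremum of the finite partial sums). It may be infinite.\<close>

definition norm1 :: "nat set \<Rightarrow> (nat \<Rightarrow> 'a::real_inner) \<Rightarrow> (nat \<Rightarrow> real set) \<Rightarrow> 'a \<Rightarrow> ereal" where
  "norm1 N e I x = (\<Sum>\<^sub>\<infinity>k\<in>N. support_fun (I k) (x \<bullet> e k))"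

text \<open>Functions into \<open>\<real> \<union> {+\<infinity>}\<close> are \<open>ereal\<close>-valued; properness excludes the value \<open>-\<infinity>\<close>.\<close>

definition proper_fun :: "('a \<Rightarrow> ereal) \<Rightarrow> bool" where
  "proper_fun \<phi> \<longleftrightarrow> (\<forall>x. \<phi> x \<noteq> -\<infinity>) \<and> (\<exists>x. \<phi> x \<noteq> \<infinity>)"

definition convex_fun :: "('a::real_vector \<Rightarrow> ereal) \<Rightarrow> bool" where
  "convex_fun \<phi> \<longleftrightarrow>
     (\<forall>x z. \<forall>t\<in>{0<..<1::real}.
        \<phi> ((1 - t) *\<^sub>R x + t *\<^sub>R z) \<le> ereal (1 - t) * \<phi> x + ereal t * \<phi> z)"

definition lsc_fun :: "('a::topological_space \<Rightarrow> ereal) \<Rightarrow> bool" where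
  "lsc_fun \<phi> \<longleftrightarrow> (\<forall>x. \<phi> x \<le> Liminf (at x) \<phi>)"

definition proper_convex_lsc :: "('a::real_normed_vector \<Rightarrow> ereal) \<Rightarrow> bool" where
  "proper_convex_lsc \<phi> \<longleftrightarrow> proper_fun \<phi> \<and> convex_fun \<phi> \<and> lsc_fun \<phi>"

definition argmin :: "('a \<Rightarrow> ereal) \<Rightarrow> 'a set" where
  "argmin \<phi> = {x. \<phi> x = (INF z. \<phi> z)}"

definition sublevel :: "('a \<Rightarrow> ereal) \<Rightarrow> real \<Rightarrow> 'a set" where
  "sublevel \<phi> r = {x. \<phi> x - (INF z. \<phi> z) < ereal r}"

text \<open>The \<open>p\<close>-th power of the distance to a set, for \<open>p > 0\<close>. The distance to the empty set is
  \<open>\<infinity>\<close>, whereas \<open>infdist x {} = 0\<close>.\<close>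

definition dist_powr :: "'a::metric_space \<Rightarrow> 'a set \<Rightarrow> real \<Rightarrow> ereal" where
  "dist_powr x S p = (if S = {} then \<infinity> else ereal (infdist x S powr p))"

definition p_conditioned_on ::
    "real \<Rightarrow> 'a::real_normed_vector set \<Rightarrow> ('a \<Rightarrow> ereal) \<Rightarrow> bool" where
  "p_conditioned_on p \<Omega> \<phi> \<longleftrightarrow>
     2 \<le> p \<and> proper_convex_lsc \<phi> \<and>
     (\<exists>\<gamma>>0::real. \<forall>x\<in>\<Omega>.
        ereal (\<gamma> / p) * dist_powr x (argmin \<phi>) p \<le> \<phi> x - (INF z. \<phi> z))"

definition finite_uniform_conditioning ::
    "nat set \<Rightarrow> (nat \<Rightarrow> 'a::real_inner) \<Rightarrow> real \<Rightarrow> ('a \<Rightarrow> ereal) \<Rightarrow> bool" where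
  "finite_uniform_conditioning N e p \<phi> \<longleftrightarrow>
     2 \<le> p \<and> proper_convex_lsc \<phi> \<and>
     (\<forall>J xbar \<delta> r. J \<subseteq> N \<longrightarrow> finite J \<longrightarrow> xbar \<in> argmin \<phi> \<longrightarrow> 0 < \<delta> \<longrightarrow> 0 < r \<longrightarrow>
        p_conditioned_on p (supp_subspace N e J \<inter> cball xbar \<delta> \<inter> sublevel \<phi> r) \<phi>)"

end

theory Submission
  imports Defs
begin

text \<open>
  The support function of a bounded closed interval around \<open>0\<close> is piecewise linear with a single
  kink: \<open>\<sigma>(t) = p t\<close> for \<open>t \<ge> 0\<close> and \<open>\<sigma>(t) = - m t\<close> for \<open>t \<le> 0\<close>, with \<open>p, m \<ge> \<omega>\<close>. Two ideas reduce
  the theorem to a finite-dimensional error bound for such functions.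

  A minimizer has finite support. Let \<open>\<eta>\<^sub>k = \<langle>y - A xbar, A e\<^sub>k\<rangle>\<close>. Varying one coordinate of \<open>xbar\<close> at
  a time shows that \<open>\<eta>\<^sub>k\<close> is a subgradient of \<open>\<sigma>\<^sub>k\<close> at \<open>xbar\<^sub>k\<close> (\<open>two_slope_stationary\<close>). By Bessel's
  inequality \<open>\<bar>\<eta>\<^sub>k\<bar> \<ge> \<omega>\<close> only for finitely many \<open>k\<close> (\<open>finite_large_dual_coefficients\<close>), and for every
  other \<open>k\<close> the number \<open>\<eta>\<^sub>k\<close> lies strictly between the two slopes, which forces \<open>xbar\<^sub>k = 0\<close>. So a
  given finite \<open>J\<close> can be enlarged to a finite \<open>K\<close> such that \<open>xbar\<close> is supported in \<open>K\<close>.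

  On vectors supported in \<open>K\<close>, the first-order terms cancel and
  \<open>f(x) - f(xbar) = \<Sum>\<^sub>k\<^sub>\<in>\<^sub>K (\<sigma>\<^sub>k(x\<^sub>k) - \<eta>\<^sub>k x\<^sub>k) + \<parallel>A(x - xbar)\<parallel>\<^sup>2 / 2\<close>. Each summand is again a
  nonnegative function with one kink, so the zero set \<open>S\<close> of the right-hand side is a polyhedron, and
  \<open>S\<close> consists of minimizers of \<open>f\<close>. Quadratic growth away from \<open>S\<close> on bounded sets (a form of
  Hoffman's error bound) follows by compactness in \<open>excess_growth\<close>: if it failed, the
  normalized vectors from nearest points \<open>z\<^sub>n \<in> S\<close> to bad points \<open>x\<^sub>n\<close> would accumulate at a direction
  \<open>u\<close> along which one can move from \<open>z\<^sub>n\<close> inside \<open>S\<close> while getting closer to \<open>x\<^sub>n\<close>.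
\<close>

section \<open>Piecewise linear functions with one kink\<close>

definition two_slope :: "real \<Rightarrow> real \<Rightarrow> real \<Rightarrow> real" where
  "two_slope p m t = p * max t 0 + m * max (- t) 0"

lemma two_slope_nonneg: "0 \<le> p \<Longrightarrow> 0 \<le> m \<Longrightarrow> 0 \<le> two_slope p m t"
  by (simp add: two_slope_def)

lemma two_slope_zero [simp]: "two_slope p m 0 = 0"
  by (simp add: two_slope_def)

lemma two_slope_minus: "two_slope p m (- t) = two_slope m p t"
  by (simp add: two_slope_def)

lemma two_slope_tilt: "two_slope (p - \<eta>) (m + \<eta>) t = two_slope p m t - \<eta> * t"
  by (simp add: two_slope_def max_def algebra_simps)

lemma continuous_on_two_slope [continuous_intros]:
  "continuous_on S f \<Longrightarrow> continuous_on S (\<lambda>x. two_slope p m (f x))"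
  unfolding two_slope_def by (intro continuous_intros)

lemma two_slope_convex:
  assumes "0 \<le> p" "0 \<le> m" "0 \<le> t" "t \<le> 1"
  shows "two_slope p m ((1 - t) * a + t * b) \<le> (1 - t) * two_slope p m a + t * two_slope p m b"
proof -
  have pos: "max ((1 - t) * a + t * b) 0 \<le> (1 - t) * max a 0 + t * max b 0" for a b :: real
  proof -
    have "(1 - t) * a \<le> (1 - t) * max a 0" "t * b \<le> t * max b 0"
      "0 \<le> (1 - t) * max a 0" "0 \<le> t * max b 0"
      using assms by (auto intro: mult_left_mono)
    then show ?thesis by (auto simp del: zero_le_mult_iff)
  qed
  have "p * max ((1 - t) * a + t * b) 0 \<le> p * ((1 - t) * max a 0 + t * max b 0)"
    using assms by (intro mult_left_mono pos) auto
  moreover have "m * max ((1 - t) * (- a) + t * (- b)) 0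
      \<le> m * ((1 - t) * max (- a) 0 + t * max (- b) 0)"
    using assms by (intro mult_left_mono pos) auto
  ultimately show ?thesis
    by (simp add: two_slope_def algebra_simps)
qed

text \<open>The slopes are the endpoints \<open>Sup S\<close> and \<open>- Inf S\<close>. They are attained, which makes the
  supremum a maximum at the endpoint selected by the sign of \<open>t\<close>.\<close>

lemma support_fun_eq_two_slope:
  assumes "bounded S" "closed S" "0 < \<omega>" "{-\<omega>..\<omega>} \<subseteq> S"
  obtains p m where "\<omega> \<le> p" "\<omega> \<le> m" "\<And>t. support_fun S t = ereal (two_slope p m t)"
proof
  have ne: "S \<noteq> {}" and mem: "\<omega> \<in> S" "- \<omega> \<in> S"
    using assms by auto
  have bdd: "bdd_above S" "bdd_below S"
    using assms by (auto simp: bounded_imp_bdd_above bounded_imp_bdd_below)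
  have attained: "Sup S \<in> S" "Inf S \<in> S"
    using closed_contains_Sup[OF ne] closed_contains_Inf[OF ne] bdd assms by auto
  have up: "s \<le> Sup S" and lo: "Inf S \<le> s" if "s \<in> S" for s
    using that bdd by (auto intro: cSup_upper cInf_lower)
  show "\<omega> \<le> Sup S" "\<omega> \<le> - Inf S"
    using up lo mem by force+
  show "support_fun S t = ereal (two_slope (Sup S) (- Inf S) t)" for t
  proof (rule antisym)
    have "s * t \<le> two_slope (Sup S) (- Inf S) t" if "s \<in> S" for s
    proof (cases "0 \<le> t")
      case True
      then show ?thesis
        using up[OF that] by (simp add: two_slope_def mult_right_mono)
    next
      case False
      then show ?thesis
        using lo[OF that] by (simp add: two_slope_def mult_right_mono_neg)
    qed
    then show "support_fun S t \<le> ereal (two_slope (Sup S) (- Inf S) t)"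
      unfolding support_fun_def by (intro SUP_least) simp
    have "two_slope (Sup S) (- Inf S) t = (if 0 \<le> t then Sup S else Inf S) * t"
      by (simp add: two_slope_def)
    then show "ereal (two_slope (Sup S) (- Inf S) t) \<le> support_fun S t"
      unfolding support_fun_def using attained
      by (intro SUP_upper2[of "if 0 \<le> t then Sup S else Inf S"]) auto
  qed
qed

text \<open>The hypothesis says that \<open>\<eta>\<close> is a subgradient at \<open>x\<close> up to a quadratic error; this is what
  minimality of \<open>two_slope\<close> plus a quadratic gives. Convexity removes the error: rescaling the step
  to \<open>l * t\<close> and dividing by \<open>l\<close> makes it vanish as \<open>l\<close> tends to \<open>0\<close>. Positive homogeneity then splits
  the subgradient inequality into equality at \<open>x\<close> and bounds on \<open>\<eta>\<close>.\<close>

lemma two_slope_stationary: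
  assumes pm: "0 \<le> p" "0 \<le> m"
    and fermat: "\<And>t. two_slope p m x + \<eta> * t - c * t\<^sup>2 \<le> two_slope p m (x + t)"
  shows "two_slope p m x = \<eta> * x" "\<eta> \<le> p" "- \<eta> \<le> m"
proof -
  have sub: "two_slope p m x + \<eta> * t \<le> two_slope p m (x + t)" for t
  proof -
    define D where "D = two_slope p m (x + t) - two_slope p m x - \<eta> * t"
    have "- (c * l * t\<^sup>2) \<le> D" if "0 < l" "l < 1" for l
    proof -
      have "two_slope p m ((1 - l) * x + l * (x + t))
          \<le> (1 - l) * two_slope p m x + l * two_slope p m (x + t)"
        using that pm by (intro two_slope_convex) auto
      moreover have "(1 - l) * x + l * (x + t) = x + l * t"
        by (simp add: algebra_simps)
      ultimately have "\<eta> * (l * t) - c * (l * t)\<^sup>2 \<le> l * (two_slope p m (x + t) - two_slope p m x)"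
        using fermat[of "l * t"] by (simp add: algebra_simps)
      then have "l * (- (c * l * t\<^sup>2)) \<le> l * D"
        by (simp add: D_def algebra_simps power2_eq_square)
      then show ?thesis using that by (simp only: mult_le_cancel_left_pos)
    qed
    then have "\<forall>\<^sub>F l in at_right 0. - (c * l * t\<^sup>2) \<le> D"
      unfolding eventually_at_right_field by (intro exI[of _ 1]) auto
    moreover have "((\<lambda>l. - (c * l * t\<^sup>2)) \<longlongrightarrow> - (c * 0 * t\<^sup>2)) (at_right 0)"
      by (intro tendsto_intros)
    ultimately have "- (c * 0 * t\<^sup>2) \<le> D"
      by (intro tendsto_upperbound[of _ _ "at_right (0::real)"]) auto
    then show ?thesis by (simp add: D_def)
  qed
  \<comment> \<open>The steps \<open>t = x\<close> and \<open>t = - x\<close> lead to \<open>2 x\<close> and \<open>0\<close>, where homogeneity gives the values.\<close>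
  have "two_slope p m (x + x) = 2 * two_slope p m x"
    by (simp add: two_slope_def max_def algebra_simps)
  then show eq: "two_slope p m x = \<eta> * x"
    using sub[of x] sub[of "- x"] by simp
  show "\<eta> \<le> p" "- \<eta> \<le> m"
    using sub[of "1 - x"] sub[of "- 1 - x"] eq by (auto simp: two_slope_def algebra_simps)
qed

text \<open>This is the one-dimensional core of the error bound. Here \<open>z n\<close> is a zero, and the step of
  length \<open>d n\<close> in the approximate direction \<open>u\<close> raises the function by only \<open>o(d n)\<close>. If the slope on the
  positive side is nonzero, such a step cannot start at the kink, so \<open>z n < 0\<close>, where the
  function is flat and there is room to move in direction \<open>u\<close>.\<close>

lemma two_slope_flat_direction_pos:
  assumes pm: "0 \<le> p" "0 \<le> m" and d: "\<And>n. 0 < d n" and u: "0 < u"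
    and w: "w \<longlonglongrightarrow> u" and \<epsilon>: "\<epsilon> \<longlonglongrightarrow> 0"
    and z: "\<And>n. two_slope p m (z n) = 0"
    and x: "\<And>n. two_slope p m (z n + d n * w n) \<le> \<epsilon> n * d n"
  shows "\<forall>\<^sub>F n in sequentially. \<forall>\<^sub>F t in at_right 0. two_slope p m (z n + t * u) = 0"
proof (cases "p = 0")
  case True
  have "two_slope p m (z n + t * u) = 0" if "0 < t" for n t
  proof (cases "z n < 0")
    case neg: True
    then have "m = 0" using z[of n] by (simp add: two_slope_def)
    with True show ?thesis by (simp add: two_slope_def)
  next
    case False
    then have "0 \<le> z n + t * u" using that u by simp
    with True show ?thesis by (simp add: two_slope_def)
  qed
  then show ?thesis
    by (auto intro!: always_eventually simp: eventually_at_right_field intro: exI[of _ 1])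
next
  case False
  with pm have p: "0 < p" by simp
  have "\<forall>\<^sub>F n in sequentially. u / 2 < w n" "\<forall>\<^sub>F n in sequentially. \<epsilon> n < p * (u / 2)"
    using order_tendstoD(1)[OF w, of "u / 2"] order_tendstoD(2)[OF \<epsilon>, of "p * (u / 2)"] u p
    by auto
  then show ?thesis
  proof eventually_elim
    case (elim n)
    have "z n \<noteq> 0"
    proof
      assume "z n = 0"
      have "0 < w n" using elim u by simp
      then have "p * (d n * w n) \<le> \<epsilon> n * d n"
        using x[of n] \<open>z n = 0\<close> d[of n] by (simp add: two_slope_def max_def mult_le_0_iff)
      then have "(p * w n) * d n \<le> \<epsilon> n * d n" by (simp add: mult_ac)
      then have "p * w n \<le> \<epsilon> n" using d[of n] by (simp only: mult_le_cancel_right_pos)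
      moreover have "p * (u / 2) < p * w n" using elim p by (intro mult_strict_left_mono)
      ultimately show False using elim by simp
    qed
    moreover have "\<not> 0 < z n" using z[of n] p by (auto simp: two_slope_def)
    ultimately have neg: "z n < 0" by simp
    then have m: "m = 0" using z[of n] by (simp add: two_slope_def)
    have "((\<lambda>t. z n + t * u) \<longlongrightarrow> z n + 0 * u) (at_right 0)"
      by (intro tendsto_intros)
    then have "\<forall>\<^sub>F t in at_right 0. z n + t * u < 0"
      using neg by (intro order_tendstoD(2)) auto
    then show ?case
      by eventually_elim (simp add: two_slope_def m)
  qed
qed

lemma two_slope_flat_direction:
  assumes pm: "0 \<le> p" "0 \<le> m" and d: "\<And>n. 0 < d n"
    and w: "w \<longlonglongrightarrow> u" and \<epsilon>: "\<epsilon> \<longlonglongrightarrow> 0"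
    and z: "\<And>n. two_slope p m (z n) = 0"
    and x: "\<And>n. two_slope p m (z n + d n * w n) \<le> \<epsilon> n * d n"
  shows "\<forall>\<^sub>F n in sequentially. \<forall>\<^sub>F t in at_right 0. two_slope p m (z n + t * u) = 0"
proof (cases u "0::real" rule: linorder_cases)
  case greater
  then show ?thesis using two_slope_flat_direction_pos[OF pm d _ w \<epsilon> z x] by simp
next
  case equal
  then show ?thesis using z by simp
next
  case less
  have flip: "two_slope m p (- a + b * - c) = two_slope p m (a + b * c)" for a b c
    using two_slope_minus[of m p "a + b * c"] by simp
  have "\<forall>\<^sub>F n in sequentially. \<forall>\<^sub>F t in at_right 0. two_slope m p (- z n + t * - u) = 0"
  proof (rule two_slope_flat_direction_pos[where d = d, OF _ _ d _ tendsto_minus[OF w] \<epsilon>])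
    show "two_slope m p (- z n + d n * - w n) \<le> \<epsilon> n * d n" for n
      using x by (simp only: flip)
  qed (use less pm z in \<open>auto simp: two_slope_minus\<close>)
  then show ?thesis by (simp only: flip)
qed

section \<open>Finite orthonormal families\<close>

lemma orthonormal_expansion:
  fixes e :: "nat \<Rightarrow> 'a::real_inner"
  assumes "finite K" and orth: "\<And>j k. j \<in> K \<Longrightarrow> k \<in> K \<Longrightarrow> e j \<bullet> e k = (if j = k then 1 else 0)"
  shows "x \<in> span (e ` K) \<longleftrightarrow> x = (\<Sum>k\<in>K. (x \<bullet> e k) *\<^sub>R e k)"
proof
  assume "x \<in> span (e ` K)"
  then show "x = (\<Sum>k\<in>K. (x \<bullet> e k) *\<^sub>R e k)"
  proof (induction rule: span_induct_alt)
    case base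
    then show ?case by simp
  next
    case (step c b y)
    then obtain j where j: "j \<in> K" "b = e j" by auto
    have "(\<Sum>k\<in>K. (e j \<bullet> e k) *\<^sub>R e k) = (\<Sum>k\<in>K. if j = k then e k else 0)"
      using orth j by (intro sum.cong) auto
    also have "\<dots> = e j" using assms(1) j by simp
    finally have "b = (\<Sum>k\<in>K. (b \<bullet> e k) *\<^sub>R e k)" using j by simp
    then have "c *\<^sub>R b = (\<Sum>k\<in>K. ((c *\<^sub>R b) \<bullet> e k) *\<^sub>R e k)"
      by (simp add: scaleR_sum_right[symmetric] flip: scaleR_scaleR)
    then have "c *\<^sub>R b + y = (\<Sum>k\<in>K. ((c *\<^sub>R b) \<bullet> e k) *\<^sub>R e k) + (\<Sum>k\<in>K. (y \<bullet> e k) *\<^sub>R e k)"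
      using step.IH by (rule arg_cong2)
    also have "\<dots> = (\<Sum>k\<in>K. ((c *\<^sub>R b + y) \<bullet> e k) *\<^sub>R e k)"
      by (simp add: inner_add_left scaleR_add_left sum.distrib)
    finally show ?case .
  qed
next
  assume "x = (\<Sum>k\<in>K. (x \<bullet> e k) *\<^sub>R e k)"
  also have "\<dots> \<in> span (e ` K)"
    by (intro span_sum span_scale span_base) auto
  finally show "x \<in> span (e ` K)" .
qed

lemma closed_span_orthonormal:
  fixes e :: "nat \<Rightarrow> 'a::real_inner"
  assumes "finite K" "\<And>j k. j \<in> K \<Longrightarrow> k \<in> K \<Longrightarrow> e j \<bullet> e k = (if j = k then 1 else 0)"
  shows "closed (span (e ` K))"
proof -
  have "span (e ` K) = {x. x = (\<Sum>k\<in>K. (x \<bullet> e k) *\<^sub>R e k)}"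
    using orthonormal_expansion[OF assms] by blast
  moreover have "closed {x. x = (\<Sum>k\<in>K. (x \<bullet> e k) *\<^sub>R e k)}"
    by (intro closed_Collect_eq continuous_intros)
  ultimately show ?thesis by simp
qed

text \<open>A ball in the span is a closed subset of the image of a product of compact intervals under the
  continuous map from coefficient families to vectors.\<close>

lemma compact_span_orthonormal:
  fixes e :: "nat \<Rightarrow> 'a::real_inner"
  assumes "finite K" and orth: "\<And>j k. j \<in> K \<Longrightarrow> k \<in> K \<Longrightarrow> e j \<bullet> e k = (if j = k then 1 else 0)"
  shows "compact (span (e ` K) \<inter> cball c r)"
proof -
  define R where "R = norm c + r"
  define T :: "(nat \<Rightarrow> real) set" where "T = PiE UNIV (\<lambda>_. {-R..R})"
  define G where "G = (\<lambda>a. \<Sum>k\<in>K. a k *\<^sub>R e k)"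
  have "compactin (product_topology (\<lambda>_::nat. euclidean) UNIV) T"
    unfolding T_def by (subst compactin_PiE) auto
  then have "compact T"
    by (simp add: euclidean_product_topology)
  moreover have "continuous_on T G"
    unfolding G_def
    by (intro continuous_intros)
       (auto intro: continuous_on_product_coordinates continuous_on_subset)
  ultimately have "compact (G ` T)"
    by (rule compact_continuous_image[rotated])
  moreover have "closed (span (e ` K) \<inter> cball c r)"
    using closed_span_orthonormal[OF assms] by auto
  moreover have "span (e ` K) \<inter> cball c r \<subseteq> G ` T"
  proof
    fix x assume x: "x \<in> span (e ` K) \<inter> cball c r"
    have "norm x \<le> R"
      using x norm_triangle_ineq2[of x c] by (auto simp: R_def dist_norm norm_minus_commute)
    define a where "a = (\<lambda>k. if k \<in> K then x \<bullet> e k else 0)"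
    have "\<bar>x \<bullet> e k\<bar> \<le> R" if "k \<in> K" for k
      using Cauchy_Schwarz_ineq2[of x "e k"] orth[OF that that] \<open>norm x \<le> R\<close>
      by (simp add: norm_eq_sqrt_inner)
    moreover have "0 \<le> R" using \<open>norm x \<le> R\<close> norm_ge_zero[of x] by linarith
    ultimately have "a k \<in> {-R..R}" for k
      by (auto simp: a_def abs_le_iff minus_le_iff)
    then have "a \<in> T"
      by (simp add: T_def PiE_def)
    moreover have "x = (\<Sum>k\<in>K. (x \<bullet> e k) *\<^sub>R e k)"
      using x orthonormal_expansion[OF assms] by blast
    then have "x = G a"
      unfolding G_def a_def by (simp cong: sum.cong)
    ultimately show "x \<in> G ` T" by blast
  qed
  ultimately show ?thesis
    by (metis compact_Int_closed inf.absorb2)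
qed

section \<open>Quadratic growth in finite dimension\<close>

text \<open>With tilted slopes \<open>p k - \<eta> k\<close> and \<open>m k + \<eta> k\<close>, this is the increase of the
  objective over its minimal value at \<open>xbar\<close>, for vectors supported in \<open>K\<close>.\<close>

definition excess ::
  "nat set \<Rightarrow> (nat \<Rightarrow> 'a::real_inner) \<Rightarrow> (nat \<Rightarrow> real) \<Rightarrow> (nat \<Rightarrow> real) \<Rightarrow>
    ('a \<Rightarrow> 'b::real_inner) \<Rightarrow> 'a \<Rightarrow> 'a \<Rightarrow> real" where
  "excess K e p m A xbar x =
     (\<Sum>k\<in>K. two_slope (p k) (m k) (x \<bullet> e k)) + 1 / 2 * (norm (A (x - xbar)))\<^sup>2"

text \<open>The bad points \<open>x\<close>, their nearest zeros \<open>z\<close>, the distances \<open>d\<close> and the unit directions \<open>w\<close>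
  satisfy \<open>x = z + d w\<close> with excess at most \<open>d\<^sup>2 / (n + 1)\<close>. For a limit \<open>u\<close> of the directions, the
  quadratic part yields \<open>A u = 0\<close>. Since \<open>d \<le> \<delta>\<close>, each one-dimensional part is at most
  \<open>\<delta> / (n + 1) * d = o(d)\<close>, so \<open>two_slope_flat_direction\<close> allows small steps from \<open>z\<close> along \<open>u\<close>
  within the zero set. Such a step decreases the distance to \<open>x\<close>, as \<open>w\<close> and \<open>u\<close> make an acute
  angle.\<close>

lemma excess_growth:
  fixes e :: "nat \<Rightarrow> 'a::real_inner" and A :: "'a \<Rightarrow> 'b::real_inner"
  assumes "finite K" and orth: "\<And>j k. j \<in> K \<Longrightarrow> k \<in> K \<Longrightarrow> e j \<bullet> e k = (if j = k then 1 else 0)"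
    and A: "bounded_linear A"
    and pm: "\<And>k. k \<in> K \<Longrightarrow> 0 \<le> p k" "\<And>k. k \<in> K \<Longrightarrow> 0 \<le> m k"
    and xbar: "xbar \<in> span (e ` K)" "excess K e p m A xbar xbar = 0"
  shows "\<exists>\<gamma>>0. \<forall>x\<in>span (e ` K) \<inter> cball xbar \<delta>.
    \<gamma> * (infdist x {z \<in> span (e ` K). excess K e p m A xbar z = 0})\<^sup>2 \<le> excess K e p m A xbar x"
proof (rule ccontr)
  interpret A: bounded_linear A by fact
  define V where "V = span (e ` K)"
  define g where "g = excess K e p m A xbar"
  define S where "S = {z \<in> V. g z = 0}"
  assume "\<not> ?thesis"
  then have bad: "\<exists>x\<in>V \<inter> cball xbar \<delta>. g x < \<gamma> * (infdist x S)\<^sup>2" if "\<gamma> > 0" for \<gamma>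
    using that unfolding V_def[symmetric] g_def[symmetric] S_def[symmetric] by (meson not_less)
  have slope: "0 \<le> two_slope (p k) (m k) t" if "k \<in> K" for k t
    using that pm by (simp add: two_slope_nonneg)
  have part: "two_slope (p k) (m k) (x \<bullet> e k) \<le> g x" if "k \<in> K" for k x
  proof -
    have "two_slope (p k) (m k) (x \<bullet> e k) \<le> (\<Sum>k\<in>K. two_slope (p k) (m k) (x \<bullet> e k))"
      using that slope assms(1) by (intro member_le_sum) auto
    then show ?thesis by (simp add: g_def excess_def add_increasing2)
  qed
  have quad: "1 / 2 * (norm (A (x - xbar)))\<^sup>2 \<le> g x" for x
    using slope by (simp add: g_def excess_def sum_nonneg)
  have g0: "0 \<le> g x" for x
    using order_trans[OF _ quad[of x]] by simp
  have S_iff: "z \<in> S \<longleftrightarrow> z \<in> V \<and> (\<forall>k\<in>K. two_slope (p k) (m k) (z \<bullet> e k) = 0) \<and> A z = A xbar" for z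
  proof
    assume z: "z \<in> S"
    then have "two_slope (p k) (m k) (z \<bullet> e k) = 0" if "k \<in> K" for k
      using part[OF that, of z] slope[OF that] by (simp add: S_def order_antisym)
    moreover have "norm (A (z - xbar)) = 0"
      using quad[of z] z by (simp add: S_def)
    ultimately show "z \<in> V \<and> (\<forall>k\<in>K. two_slope (p k) (m k) (z \<bullet> e k) = 0) \<and> A z = A xbar"
      using z by (simp add: S_def A.diff)
  qed (simp add: S_def g_def excess_def A.diff)
  have xS: "xbar \<in> S" using xbar by (simp add: S_def V_def g_def)
  have nearest: "\<exists>z\<in>S. \<forall>s\<in>S. dist x z \<le> dist x s" if "x \<in> V" for x
  proof -
    have "continuous_on UNIV g"
      unfolding g_def excess_def
      by (intro continuous_intros A.continuous_on)
    then have "closed {z. g z = 0}"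
      by (intro closed_Collect_eq continuous_intros)
    then have "compact ((V \<inter> cball x (dist x xbar)) \<inter> {z. g z = 0})"
      unfolding V_def by (intro compact_Int_closed compact_span_orthonormal assms(1) orth)
    also have "(V \<inter> cball x (dist x xbar)) \<inter> {z. g z = 0} = S \<inter> cball x (dist x xbar)"
      by (auto simp: S_def)
    finally have "compact (S \<inter> cball x (dist x xbar))" .
    moreover have "S \<inter> cball x (dist x xbar) \<noteq> {}" using xS by auto
    moreover have "continuous_on (S \<inter> cball x (dist x xbar)) (\<lambda>z. dist x z)"
      by (intro continuous_intros)
    ultimately obtain z where z: "z \<in> S \<inter> cball x (dist x xbar)"
      "\<And>s. s \<in> S \<inter> cball x (dist x xbar) \<Longrightarrow> dist x z \<le> dist x s"
      using continuous_attains_inf by metis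
    then have "dist x z \<le> dist x s" if "s \<in> S" for s
      using that by (cases "s \<in> cball x (dist x xbar)") auto
    with z show ?thesis by blast
  qed
  \<comment> \<open>The nearest point replaces the infimal distance, so that minimality of \<open>z\<close> can be contradicted.\<close>
  have "\<exists>x z. x \<in> V \<and> dist xbar x \<le> \<delta> \<and> z \<in> S \<and> (\<forall>s\<in>S. dist x z \<le> dist x s)
      \<and> g x < 1 / real (Suc n) * (dist x z)\<^sup>2" for n
  proof -
    obtain x where x: "x \<in> V" "dist xbar x \<le> \<delta>" "g x < 1 / real (Suc n) * (infdist x S)\<^sup>2"
      using bad[of "1 / real (Suc n)"] by auto
    obtain z where z: "z \<in> S" "\<forall>s\<in>S. dist x z \<le> dist x s"
      using nearest[OF x(1)] by blast
    have "(infdist x S)\<^sup>2 \<le> (dist x z)\<^sup>2"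
      using z by (intro power_mono infdist_le infdist_nonneg)
    then have "1 / real (Suc n) * (infdist x S)\<^sup>2 \<le> 1 / real (Suc n) * (dist x z)\<^sup>2"
      by (intro mult_left_mono) auto
    with x z show ?thesis by fastforce
  qed
  then obtain x z where x: "\<And>n. x n \<in> V" "\<And>n. dist xbar (x n) \<le> \<delta>" and z: "\<And>n. z n \<in> S"
    and near: "\<And>n s. s \<in> S \<Longrightarrow> dist (x n) (z n) \<le> dist (x n) s"
    and small: "\<And>n. g (x n) < 1 / real (Suc n) * (dist (x n) (z n))\<^sup>2"
    by metis
  define d where "d n = dist (x n) (z n)" for n
  define w where "w n = (x n - z n) /\<^sub>R d n" for n
  have d0: "0 < d n" for n
    using small[of n] g0[of "x n"] by (cases "x n = z n") (auto simp: d_def)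
  have d\<delta>: "d n \<le> \<delta>" for n
    using near[OF xS, of n] x(2)[of n] by (simp add: d_def dist_commute)
  have xw: "x n = z n + d n *\<^sub>R w n" for n
    using d0[of n] by (simp add: w_def)
  have normw: "norm (w n) = 1" for n
    using d0[of n] by (simp add: w_def d_def dist_norm)
  have "w n \<in> V \<inter> cball 0 1" for n
    using x z normw[of n] by (auto simp: w_def V_def S_def intro!: span_scale span_diff)
  moreover have "compact (V \<inter> cball 0 1)"
    unfolding V_def by (intro compact_span_orthonormal assms(1) orth)
  ultimately obtain u r where u: "u \<in> V" and r: "strict_mono r" and lim: "(w \<circ> r) \<longlonglongrightarrow> u"
    unfolding compact_def by (metis IntD1)
  have \<epsilon>: "(\<lambda>n. c / real (Suc (r n))) \<longlonglongrightarrow> 0" for c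
    using LIMSEQ_subseq_LIMSEQ[OF LIMSEQ_Suc[OF lim_const_over_n[of c]] r] by (simp add: o_def)
  have lim': "(\<lambda>n. w (r n)) \<longlonglongrightarrow> u" using lim by (simp add: o_def)
  have normu: "norm u = 1"
    using tendsto_norm[OF lim'] by (simp add: normw LIMSEQ_const_iff)
  have "(norm (A (w n)))\<^sup>2 \<le> 2 / real (Suc n)" for n
  proof -
    have "A (x n - xbar) = d n *\<^sub>R A (w n)"
      using z[of n] by (subst xw) (simp add: S_iff A.diff A.add A.scale)
    then have "1 / 2 * ((d n)\<^sup>2 * (norm (A (w n)))\<^sup>2) \<le> 1 / real (Suc n) * (d n)\<^sup>2"
      using order_trans[OF quad less_imp_le[OF small[of n]]] by (simp add: power_mult_distrib d_def)
    moreover have "(d n)\<^sup>2 * (2 / real (Suc n)) = 2 * (1 / real (Suc n) * (d n)\<^sup>2)"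
      by simp
    ultimately have "(d n)\<^sup>2 * (norm (A (w n)))\<^sup>2 \<le> (d n)\<^sup>2 * (2 / real (Suc n))"
      by linarith
    then show ?thesis using d0[of n] by (simp only: mult_le_cancel_left_pos zero_less_power)
  qed
  then have "(norm (A u))\<^sup>2 \<le> 0"
    by (intro LIMSEQ_le[OF tendsto_power[OF tendsto_norm[OF A.tendsto[OF lim']]] \<epsilon>[of 2]]) auto
  then have Au: "A u = 0" by simp
  have "\<forall>\<^sub>F n in sequentially. \<forall>\<^sub>F t in at_right 0.
      two_slope (p k) (m k) (z (r n) \<bullet> e k + t * (u \<bullet> e k)) = 0" if k: "k \<in> K" for k
  proof (rule two_slope_flat_direction[where d = "\<lambda>n. d (r n)" and \<epsilon> = "\<lambda>n. \<delta> / real (Suc (r n))"])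
    show "0 \<le> p k" "0 \<le> m k" "0 < d (r n)" for n using pm k d0 by auto
    show "(\<lambda>n. w (r n) \<bullet> e k) \<longlonglongrightarrow> u \<bullet> e k" by (intro tendsto_intros lim')
    show "(\<lambda>n. \<delta> / real (Suc (r n))) \<longlonglongrightarrow> 0" by (rule \<epsilon>)
    show "two_slope (p k) (m k) (z (r n) \<bullet> e k) = 0" for n using z k by (simp add: S_iff)
    show "two_slope (p k) (m k) (z (r n) \<bullet> e k + d (r n) * (w (r n) \<bullet> e k))
        \<le> \<delta> / real (Suc (r n)) * d (r n)" for n
    proof -
      have "two_slope (p k) (m k) (x (r n) \<bullet> e k) \<le> 1 / real (Suc (r n)) * (d (r n))\<^sup>2"
        using part[OF k, of "x (r n)"] small[of "r n"] by (simp add: d_def)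
      also have "(d (r n))\<^sup>2 \<le> \<delta> * d (r n)"
        using d\<delta>[of "r n"] d0[of "r n"] by (simp add: power2_eq_square)
      finally have "two_slope (p k) (m k) (x (r n) \<bullet> e k) \<le> 1 / real (Suc (r n)) * (\<delta> * d (r n))"
        by (simp add: divide_right_mono)
      moreover have "x (r n) \<bullet> e k = z (r n) \<bullet> e k + d (r n) * (w (r n) \<bullet> e k)"
        by (subst xw) (simp add: inner_add_left)
      ultimately show ?thesis by simp
    qed
  qed
  then have "\<forall>\<^sub>F n in sequentially. \<forall>k\<in>K. \<forall>\<^sub>F t in at_right 0.
      two_slope (p k) (m k) (z (r n) \<bullet> e k + t * (u \<bullet> e k)) = 0"
    using assms(1) by (simp add: eventually_ball_finite)
  moreover have "\<forall>\<^sub>F n in sequentially. 0 < w (r n) \<bullet> u"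
  proof -
    have "(\<lambda>n. w (r n) \<bullet> u) \<longlonglongrightarrow> u \<bullet> u" by (intro tendsto_intros lim')
    moreover have "0 < u \<bullet> u" using normu by (auto simp: inner_gt_zero_iff)
    ultimately show ?thesis by (rule order_tendstoD(1))
  qed
  ultimately have "\<forall>\<^sub>F n in sequentially. 0 < w (r n) \<bullet> u \<and> (\<forall>k\<in>K. \<forall>\<^sub>F t in at_right 0.
      two_slope (p k) (m k) (z (r n) \<bullet> e k + t * (u \<bullet> e k)) = 0)"
    by eventually_elim auto
  then obtain n where n: "0 < w (r n) \<bullet> u"
    "\<forall>k\<in>K. \<forall>\<^sub>F t in at_right 0. two_slope (p k) (m k) (z (r n) \<bullet> e k + t * (u \<bullet> e k)) = 0"
    using eventually_happens'[OF sequentially_bot] by blast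
  \<comment> \<open>Moving \<open>z\<close> by \<open>t u\<close> changes the squared distance to \<open>x\<close> by \<open>t\<^sup>2 - t q\<close>.\<close>
  define q where "q = 2 * (d (r n) * (w (r n) \<bullet> u))"
  have "0 < q" using n(1) d0[of "r n"] by (simp add: q_def)
  then have "\<forall>\<^sub>F t in at_right 0. 0 < t \<and> t < q"
    by (auto simp: eventually_at_right_field)
  moreover have "\<forall>\<^sub>F t in at_right 0. \<forall>k\<in>K.
      two_slope (p k) (m k) (z (r n) \<bullet> e k + t * (u \<bullet> e k)) = 0"
    using n(2) assms(1) by (simp add: eventually_ball_finite)
  ultimately have "\<forall>\<^sub>F t in at_right 0. (0 < t \<and> t < q) \<and>
      (\<forall>k\<in>K. two_slope (p k) (m k) (z (r n) \<bullet> e k + t * (u \<bullet> e k)) = 0)"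
    by (rule eventually_conj)
  then obtain t where t: "0 < t" "t < q"
    "\<forall>k\<in>K. two_slope (p k) (m k) (z (r n) \<bullet> e k + t * (u \<bullet> e k)) = 0"
    using eventually_happens'[OF trivial_limit_at_right_real] by blast
  have "z (r n) + t *\<^sub>R u \<in> S"
    using z[of "r n"] t(3) u Au
    by (auto simp: S_iff V_def inner_add_left A.add A.scale intro!: span_add span_scale)
  then have "d (r n) \<le> dist (x (r n)) (z (r n) + t *\<^sub>R u)"
    unfolding d_def by (rule near)
  moreover have "x (r n) - (z (r n) + t *\<^sub>R u) = d (r n) *\<^sub>R w (r n) - t *\<^sub>R u"
    by (subst xw) simp
  ultimately have "d (r n) \<le> norm (d (r n) *\<^sub>R w (r n) - t *\<^sub>R u)"
    by (simp add: dist_norm)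
  then have "(d (r n))\<^sup>2 \<le> (norm (d (r n) *\<^sub>R w (r n) - t *\<^sub>R u))\<^sup>2"
    using d0[of "r n"] by (intro power_mono) auto
  also have "\<dots> = (d (r n))\<^sup>2 - t * q + t\<^sup>2"
    using normw[of "r n"] normu unfolding q_def power2_norm_eq_inner
    by (simp add: inner_diff_left inner_diff_right inner_commute
        power2_eq_square norm_eq_1 algebra_simps)
  finally have "t * q \<le> t * t" by (simp add: power2_eq_square)
  moreover have "t * t < t * q"
    using t(1,2) by (rule mult_strict_left_mono[rotated])
  ultimately show False by linarith
qed

section \<open>Dual coefficients and supports in Hilbert space\<close>

text \<open>Bessel's inequality for the adjoint of \<open>A\<close> at \<open>w\<close>, without forming the adjoint: for
  \<open>v = \<Sum> \<eta>\<^sub>k e\<^sub>k\<close> over finitely many indices, \<open>\<parallel>v\<parallel>\<^sup>2 = \<Sum> \<eta>\<^sub>k\<^sup>2 = \<langle>w, A v\<rangle>\<close>, so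
  \<open>\<parallel>v\<parallel>\<close> is at most \<open>\<parallel>w\<parallel>\<close> times a bound for \<open>A\<close>, and this bounds the number of large \<open>\<eta>\<^sub>k\<close>.\<close>

lemma finite_large_dual_coefficients:
  fixes e :: "nat \<Rightarrow> 'a::real_inner" and A :: "'a \<Rightarrow> 'b::real_inner"
  assumes orth: "\<And>j k. j \<in> N \<Longrightarrow> k \<in> N \<Longrightarrow> e j \<bullet> e k = (if j = k then 1 else 0)"
    and "bounded_linear A" and "0 < \<omega>"
  shows "finite {k \<in> N. \<omega> \<le> \<bar>w \<bullet> A (e k)\<bar>}"
proof -
  interpret A: bounded_linear A by fact
  obtain B where B: "0 \<le> B" "\<And>x. norm (A x) \<le> norm x * B"
    using A.nonneg_bounded by blast
  have "card F \<le> nat \<lfloor>(norm w * B)\<^sup>2 / \<omega>\<^sup>2\<rfloor>"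
    if F: "F \<subseteq> {k \<in> N. \<omega> \<le> \<bar>w \<bullet> A (e k)\<bar>}" "finite F" for F
  proof -
    define \<eta> where "\<eta> k = w \<bullet> A (e k)" for k
    define v where "v = (\<Sum>k\<in>F. \<eta> k *\<^sub>R e k)"
    define s where "s = (\<Sum>k\<in>F. (\<eta> k)\<^sup>2)"
    have "v \<bullet> v = (\<Sum>j\<in>F. \<Sum>k\<in>F. \<eta> j * (\<eta> k * (e k \<bullet> e j)))"
      by (simp add: v_def inner_sum_left inner_sum_right sum_distrib_left)
    also have "\<dots> = (\<Sum>j\<in>F. \<Sum>k\<in>F. if j = k then (\<eta> k)\<^sup>2 else 0)"
      using F orth by (intro sum.cong refl) (auto simp: power2_eq_square subset_iff)
    also have "\<dots> = s" using F by (simp add: s_def)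
    finally have normv: "(norm v)\<^sup>2 = s" by (simp add: power2_norm_eq_inner)
    have "s = w \<bullet> A v"
      by (simp add: v_def s_def A.sum A.scale inner_sum_right \<eta>_def power2_eq_square)
    also have "\<dots> \<le> norm w * (norm v * B)"
      using norm_cauchy_schwarz[of w "A v"] mult_left_mono[OF B(2)[of v], of "norm w"] by simp
    finally have "norm v * norm v \<le> norm v * (norm w * B)"
      using normv by (simp add: power2_eq_square mult_ac)
    then have "norm v \<le> norm w * B"
      using B(1) by (cases "v = 0") auto
    then have "s \<le> (norm w * B)\<^sup>2"
      using power_mono[of "norm v" "norm w * B" 2] normv by simp
    moreover have "(\<Sum>k\<in>F. \<omega>\<^sup>2) \<le> s"
      unfolding s_def
    proof (intro sum_mono)
      fix k assume "k \<in> F"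
      then have "\<omega>\<^sup>2 \<le> \<bar>\<eta> k\<bar>\<^sup>2"
        using F assms(3) by (intro power_mono) (auto simp: \<eta>_def)
      then show "\<omega>\<^sup>2 \<le> (\<eta> k)\<^sup>2" by simp
    qed
    ultimately have "real (card F) * \<omega>\<^sup>2 \<le> (norm w * B)\<^sup>2" by simp
    then have "real (card F) \<le> (norm w * B)\<^sup>2 / \<omega>\<^sup>2"
      using assms(3) by (simp add: pos_le_divide_eq)
    then show ?thesis by linarith
  qed
  then show ?thesis
    by (intro finite_if_finite_subsets_card_bdd[THEN conjunct1]) blast
qed

text \<open>Totality of the basis enters here: a vector minus its expansion over \<open>K\<close> is orthogonal to
  all basis vectors, hence to the closure of their span, hence to itself.\<close>

lemma mem_supp_subspace_iff_span:
  fixes e :: "nat \<Rightarrow> 'a::real_inner"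
  assumes onb: "orthonormal_basis N e" and K: "finite K" "K \<subseteq> N"
  shows "x \<in> supp_subspace N e K \<longleftrightarrow> x \<in> span (e ` K)"
proof -
  have orth: "e j \<bullet> e k = (if j = k then 1 else 0)" if "j \<in> N" "k \<in> N" for j k
    using onb that by (simp add: orthonormal_basis_def)
  have orthK: "e j \<bullet> e k = (if j = k then 1 else 0)" if "j \<in> K" "k \<in> K" for j k
    using orth that K by blast
  define d where "d = x - (\<Sum>k\<in>K. (x \<bullet> e k) *\<^sub>R e k)"
  have coord: "(\<Sum>k\<in>K. (x \<bullet> e k) *\<^sub>R e k) \<bullet> e j = (if j \<in> K then x \<bullet> e j else 0)" if "j \<in> N" for j
  proof -
    have "(\<Sum>k\<in>K. (x \<bullet> e k) *\<^sub>R e k) \<bullet> e j = (\<Sum>k\<in>K. (x \<bullet> e k) * (e k \<bullet> e j))"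
      by (simp add: inner_sum_left)
    also have "\<dots> = (\<Sum>k\<in>K. if k = j then x \<bullet> e k else 0)"
      using orth that K by (intro sum.cong) auto
    finally have "(\<Sum>k\<in>K. (x \<bullet> e k) *\<^sub>R e k) \<bullet> e j = (\<Sum>k\<in>K. if k = j then x \<bullet> e k else 0)" .
    then show ?thesis using K by simp
  qed
  show ?thesis
  proof
    assume "x \<in> supp_subspace N e K"
    then have "d \<bullet> e j = 0" if "j \<in> N" for j
      using coord[OF that] that by (auto simp: d_def inner_diff_left supp_subspace_def supp_def)
    then have "span (e ` N) \<subseteq> {v. d \<bullet> v = 0}"
      by (intro span_minimal subspace_hyperplane) auto
    then have "closure (span (e ` N)) \<subseteq> {v. d \<bullet> v = 0}"
      by (intro closure_minimal closed_hyperplane)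
    moreover have "closure (span (e ` N)) = UNIV"
      using onb by (simp add: orthonormal_basis_def)
    ultimately have "d \<in> {v. d \<bullet> v = 0}" by blast
    then show "x \<in> span (e ` K)"
      using orthonormal_expansion[OF K(1) orthK] by (simp add: d_def)
  next
    assume "x \<in> span (e ` K)"
    then have expand: "x = (\<Sum>k\<in>K. (x \<bullet> e k) *\<^sub>R e k)"
      using orthonormal_expansion[OF K(1) orthK] by blast
    have "x \<bullet> e j = 0" if "j \<in> N" "j \<notin> K" for j
      using arg_cong[OF expand, of "\<lambda>v. v \<bullet> e j"] coord[OF that(1)] that(2) by (simp only: if_False)
    then show "x \<in> supp_subspace N e K"
      by (auto simp: supp_subspace_def supp_def)
  qed
qed

section \<open>The regularized least squares functional\<close>

text \<open>Convexity and lower semicontinuity pass to suprema. This avoids calculating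
  with infinite sums in \<open>ereal\<close>, where addition is not continuous.\<close>

lemma proper_convex_lsc_SUP:
  fixes \<phi> :: "'i \<Rightarrow> 'a::real_normed_vector \<Rightarrow> real"
  assumes f: "\<And>x. f x = (SUP i\<in>T. ereal (\<phi> i x))" and "T \<noteq> {}" and "f a \<noteq> \<infinity>"
    and conv: "\<And>i. i \<in> T \<Longrightarrow> convex_on UNIV (\<phi> i)"
    and cont: "\<And>i. i \<in> T \<Longrightarrow> continuous_on UNIV (\<phi> i)"
  shows "proper_convex_lsc f"
  unfolding proper_convex_lsc_def
proof (intro conjI)
  have le: "ereal (\<phi> i x) \<le> f x" if "i \<in> T" for i x
    unfolding f using that by (rule SUP_upper)
  obtain i where i: "i \<in> T" using \<open>T \<noteq> {}\<close> by blast
  have "f x \<noteq> - \<infinity>" for x using le[OF i, of x] by auto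
  then show "proper_fun f"
    using assms(3) by (auto simp: proper_fun_def)
  show "convex_fun f"
    unfolding convex_fun_def
  proof (intro allI ballI)
    fix x z :: 'a and t :: real assume t: "t \<in> {0<..<1}"
    have "ereal (\<phi> i ((1 - t) *\<^sub>R x + t *\<^sub>R z)) \<le> ereal (1 - t) * f x + ereal t * f z"
      if i: "i \<in> T" for i
    proof -
      have "ereal (\<phi> i ((1 - t) *\<^sub>R x + t *\<^sub>R z)) \<le> ereal ((1 - t) * \<phi> i x + t * \<phi> i z)"
        using convex_onD[OF conv[OF i], of t x z] t by simp
      also have "\<dots> = ereal (1 - t) * ereal (\<phi> i x) + ereal t * ereal (\<phi> i z)"
        by simp
      also have "\<dots> \<le> ereal (1 - t) * f x + ereal t * f z"
        using t by (intro add_mono ereal_mult_left_mono le i) auto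
      finally show ?thesis .
    qed
    then show "f ((1 - t) *\<^sub>R x + t *\<^sub>R z) \<le> ereal (1 - t) * f x + ereal t * f z"
      by (subst f) (rule SUP_least)
  qed
  show "lsc_fun f"
    unfolding lsc_fun_def le_Liminf_iff
  proof (intro allI impI)
    fix x c assume "c < f x"
    then obtain i where i: "i \<in> T" "c < ereal (\<phi> i x)"
      by (auto simp: f less_SUP_iff)
    have "((\<lambda>z. ereal (\<phi> i z)) \<longlongrightarrow> ereal (\<phi> i x)) (at x)"
      using cont[OF i(1)] by (intro tendsto_intros) (simp add: continuous_on_def)
    from order_tendstoD(1)[OF this i(2)] show "\<forall>\<^sub>F z in at x. c < f z"
    proof eventually_elim
      case (elim z)
      then show ?case using le[OF i(1), of z] by (rule order_less_le_trans)
    qed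
  qed
qed

lemma norm1_SUP:
  assumes h: "\<And>k t. k \<in> N \<Longrightarrow> support_fun (I k) t = ereal (two_slope (p k) (m k) t)"
    and pm: "\<And>k. k \<in> N \<Longrightarrow> 0 \<le> p k" "\<And>k. k \<in> N \<Longrightarrow> 0 \<le> m k"
  shows "norm1 N e I x =
    (SUP F\<in>{F. finite F \<and> F \<subseteq> N}. ereal (\<Sum>k\<in>F. two_slope (p k) (m k) (x \<bullet> e k)))"
proof -
  have "norm1 N e I x = (SUP F\<in>{F. finite F \<and> F \<subseteq> N}. \<Sum>k\<in>F. support_fun (I k) (x \<bullet> e k))"
    unfolding norm1_def using h pm two_slope_nonneg by (intro nonneg_infsum_complete) simp
  also have "\<dots> = (SUP F\<in>{F. finite F \<and> F \<subseteq> N}. ereal (\<Sum>k\<in>F. two_slope (p k) (m k) (x \<bullet> e k)))"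
    using h by (intro SUP_cong refl) (simp add: subset_iff flip: sum_ereal)
  finally show ?thesis .
qed

lemma norm1_finite_support:
  assumes h: "\<And>k t. k \<in> N \<Longrightarrow> support_fun (I k) t = ereal (two_slope (p k) (m k) t)"
    and K: "finite K" "K \<subseteq> N" and x: "x \<in> supp_subspace N e K"
  shows "norm1 N e I x = ereal (\<Sum>k\<in>K. two_slope (p k) (m k) (x \<bullet> e k))"
proof -
  have "x \<bullet> e k = 0" if "k \<in> N - K" for k
    using x that by (auto simp: supp_subspace_def supp_def)
  then have "norm1 N e I x = (\<Sum>\<^sub>\<infinity>k\<in>K. support_fun (I k) (x \<bullet> e k))"
    unfolding norm1_def using h K by (intro infsum_cong_neutral) auto
  also have "\<dots> = (\<Sum>k\<in>K. support_fun (I k) (x \<bullet> e k))"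
    using K by simp
  also have "\<dots> = ereal (\<Sum>k\<in>K. two_slope (p k) (m k) (x \<bullet> e k))"
    using h K by (simp add: subset_iff flip: sum_ereal)
  finally show ?thesis .
qed

text \<open>Equality holds, but splitting a term off an infinite \<open>ereal\<close> sum is awkward; the inequality,
  proved on finite partial sums, suffices to test minimality along a basis vector.\<close>

lemma norm1_single_coordinate_change:
  assumes h: "\<And>k t. k \<in> N \<Longrightarrow> support_fun (I k) t = ereal (two_slope (p k) (m k) t)"
    and pm: "\<And>k. k \<in> N \<Longrightarrow> 0 \<le> p k" "\<And>k. k \<in> N \<Longrightarrow> 0 \<le> m k"
    and j: "j \<in> N" and off: "\<And>k. k \<in> N \<Longrightarrow> k \<noteq> j \<Longrightarrow> x' \<bullet> e k = x \<bullet> e k"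
  shows "norm1 N e I x' \<le> norm1 N e I x
    + ereal (two_slope (p j) (m j) (x' \<bullet> e j) - two_slope (p j) (m j) (x \<bullet> e j))"
proof -
  define \<sigma> where "\<sigma> x k = two_slope (p k) (m k) (x \<bullet> e k)" for x k
  have Sup: "norm1 N e I x = (SUP F\<in>{F. finite F \<and> F \<subseteq> N}. ereal (sum (\<sigma> x) F))" for x
    unfolding \<sigma>_def using h pm by (rule norm1_SUP)
  have "ereal (sum (\<sigma> x') F) \<le> norm1 N e I x + ereal (\<sigma> x' j - \<sigma> x j)"
    if F: "finite F" "F \<subseteq> N" for F
  proof -
    have "sum (\<sigma> x') F \<le> sum (\<sigma> x') (insert j F)"
      using F j pm by (intro sum_mono2) (auto simp: \<sigma>_def two_slope_nonneg)
    also have "\<dots> = sum (\<sigma> x) (insert j F) + (\<sigma> x' j - \<sigma> x j)"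
    proof -
      have "sum (\<sigma> x') (F - {j}) = sum (\<sigma> x) (F - {j})"
        using F off by (intro sum.cong) (auto simp: \<sigma>_def)
      then show ?thesis using F by (simp add: sum.insert_remove)
    qed
    finally have "ereal (sum (\<sigma> x') F) \<le> ereal (sum (\<sigma> x) (insert j F)) + ereal (\<sigma> x' j - \<sigma> x j)"
      by simp
    also have "ereal (sum (\<sigma> x) (insert j F)) \<le> norm1 N e I x"
      unfolding Sup using F j by (intro SUP_upper) auto
    finally show ?thesis by (simp add: add_right_mono)
  qed
  then show ?thesis
    by (subst Sup) (auto simp: \<sigma>_def intro!: SUP_least)
qed

lemma convex_on_half_norm_square_affine:
  fixes A :: "'a::real_inner \<Rightarrow> 'b::real_inner"
  assumes "linear A"
  shows "convex_on UNIV (\<lambda>x. 1 / 2 * (norm (A x - y))\<^sup>2)"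
proof (rule convex_onI)
  interpret linear A by fact
  fix t :: real and x z :: 'a assume t: "0 < t" "t < 1"
  define a where "a = A x - y"
  define b where "b = A z - y"
  have "A ((1 - t) *\<^sub>R x + t *\<^sub>R z) - y = (1 - t) *\<^sub>R a + t *\<^sub>R b"
    by (simp only: add scale) (simp add: a_def b_def algebra_simps)
  moreover have "(norm ((1 - t) *\<^sub>R a + t *\<^sub>R b))\<^sup>2
      = (1 - t) * (norm a)\<^sup>2 + t * (norm b)\<^sup>2 - t * (1 - t) * (norm (a - b))\<^sup>2"
    unfolding power2_norm_eq_inner
    by (simp add: inner_add_left inner_add_right inner_diff_left inner_diff_right
        inner_commute algebra_simps power2_eq_square)
  moreover have "0 \<le> t * (1 - t) * (norm (a - b))\<^sup>2" using t by simp
  ultimately show "1 / 2 * (norm (A ((1 - t) *\<^sub>R x + t *\<^sub>R z) - y))\<^sup>2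
      \<le> (1 - t) * (1 / 2 * (norm (A x - y))\<^sup>2) + t * (1 / 2 * (norm (A z - y))\<^sup>2)"
    by (simp add: a_def b_def)
qed simp

lemma convex_on_two_slope_inner:
  assumes "0 \<le> p" "0 \<le> m"
  shows "convex_on UNIV (\<lambda>x. two_slope p m (x \<bullet> v))"
  using assms by (intro convex_onI) (auto simp: inner_add_left intro!: two_slope_convex)

lemma proper_convex_lsc_regularized_least_squares:
  fixes e :: "nat \<Rightarrow> 'a::real_inner" and A :: "'a \<Rightarrow> 'b::real_inner"
  assumes h: "\<And>k t. k \<in> N \<Longrightarrow> support_fun (I k) t = ereal (two_slope (p k) (m k) t)"
    and pm: "\<And>k. k \<in> N \<Longrightarrow> 0 \<le> p k" "\<And>k. k \<in> N \<Longrightarrow> 0 \<le> m k"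
    and A: "bounded_linear A"
  shows "proper_convex_lsc (\<lambda>x. norm1 N e I x + ereal (1 / 2 * (norm (A x - y))\<^sup>2))"
proof (rule proper_convex_lsc_SUP)
  interpret A: bounded_linear A by fact
  let ?T = "{F. finite F \<and> F \<subseteq> N}"
  show "?T \<noteq> {}" by auto
  show "norm1 N e I x + ereal (1 / 2 * (norm (A x - y))\<^sup>2) = (SUP F\<in>?T.
      ereal ((\<Sum>k\<in>F. two_slope (p k) (m k) (x \<bullet> e k)) + 1 / 2 * (norm (A x - y))\<^sup>2))" for x
  proof -
    have "norm1 N e I x = (SUP F\<in>?T. ereal (\<Sum>k\<in>F. two_slope (p k) (m k) (x \<bullet> e k)))"
      using h pm by (rule norm1_SUP)
    then show ?thesis
      unfolding plus_ereal.simps(1)[symmetric]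
      by (simp only:) (rule SUP_ereal_add_left[symmetric], auto)
  qed
  have "(0::'a) \<in> supp_subspace N e {}"
    by (simp add: supp_subspace_def supp_def)
  then show "norm1 N e I 0 + ereal (1 / 2 * (norm (A 0 - y))\<^sup>2) \<noteq> \<infinity>"
    by (subst norm1_finite_support[OF h, where K = "{}"]) auto
  fix F assume "F \<in> ?T"
  then have F: "finite F" "F \<subseteq> N" by auto
  show "continuous_on UNIV (\<lambda>x. (\<Sum>k\<in>F. two_slope (p k) (m k) (x \<bullet> e k)) + 1 / 2 * (norm (A x - y))\<^sup>2)"
    by (intro continuous_intros A.continuous_on)
  show "convex_on UNIV (\<lambda>x. (\<Sum>k\<in>F. two_slope (p k) (m k) (x \<bullet> e k)) + 1 / 2 * (norm (A x - y))\<^sup>2)"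
  proof (rule convex_on_add)
    show "convex_on UNIV (\<lambda>x. \<Sum>k\<in>F. two_slope (p k) (m k) (x \<bullet> e k))"
      using F
    proof (induction F)
      case empty
      then show ?case by (simp add: convex_on_const)
    next
      case (insert k F)
      then show ?case
        using pm by (simp add: convex_on_add convex_on_two_slope_inner)
    qed
    show "convex_on UNIV (\<lambda>x. 1 / 2 * (norm (A x - y))\<^sup>2)"
      using A.linear_axioms by (rule convex_on_half_norm_square_affine)
  qed
qed

theorem proposition4p7:
  fixes N :: "nat set"
    and e :: "nat \<Rightarrow> 'a::{real_inner, complete_space}"
    and A :: "'a \<Rightarrow> 'b::{real_inner, complete_space}"
    and y :: 'b
    and I :: "nat \<Rightarrow> real set"
    and \<omega> :: real
  assumes "separable_space (euclidean :: 'a topology)"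
    and "separable_space (euclidean :: 'b topology)"
    and "orthonormal_basis N e"
    and "bounded_linear A"
    and "\<And>k. k \<in> N \<Longrightarrow> is_interval (I k) \<and> bounded (I k) \<and> closed (I k)"
    and "0 < \<omega>"
    and "\<And>k. k \<in> N \<Longrightarrow> {-\<omega>..\<omega>} \<subseteq> I k"
  shows "finite_uniform_conditioning N e 2
           (\<lambda>x. norm1 N e I x + ereal (1 / 2 * (norm (A x - y))\<^sup>2))"
proof -
  interpret A: bounded_linear A by fact
  define f where "f x = norm1 N e I x + ereal (1 / 2 * (norm (A x - y))\<^sup>2)" for x
  have "\<exists>p m. \<omega> \<le> p \<and> \<omega> \<le> m \<and> (\<forall>t. support_fun (I k) t = ereal (two_slope p m t))" if "k \<in> N" for k
    using support_fun_eq_two_slope[of "I k" \<omega>] assms(5-7) that by metis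
  then obtain p m where \<omega>pm: "\<And>k. k \<in> N \<Longrightarrow> \<omega> \<le> p k" "\<And>k. k \<in> N \<Longrightarrow> \<omega> \<le> m k"
    and h: "\<And>k t. k \<in> N \<Longrightarrow> support_fun (I k) t = ereal (two_slope (p k) (m k) t)"
    by metis
  have pm: "0 \<le> p k" "0 \<le> m k" if "k \<in> N" for k
    using \<omega>pm[OF that] assms(6) by auto
  have orth: "e j \<bullet> e k = (if j = k then 1 else 0)" if "j \<in> N" "k \<in> N" for j k
    using assms(3) that by (simp add: orthonormal_basis_def)
  have pcl: "proper_convex_lsc f"
    unfolding f_def using h pm assms(4) by (rule proper_convex_lsc_regularized_least_squares)
  have "p_conditioned_on 2 (supp_subspace N e J \<inter> cball xbar \<delta> \<inter> sublevel f r) f"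
    if J: "J \<subseteq> N" "finite J" and xbar: "xbar \<in> argmin f" for J xbar \<delta> r
  proof -
    have min: "f xbar = (INF z. f z)" using xbar by (simp add: argmin_def)
    then have le: "f xbar \<le> f x" for x by (simp add: INF_lower)
    obtain a where "f a \<noteq> \<infinity>" and "f xbar \<noteq> - \<infinity>"
      using pcl by (auto simp: proper_convex_lsc_def proper_fun_def)
    then obtain c where c: "f xbar = ereal c"
      using le[of a] by (cases "f xbar") auto
    then obtain b where b: "norm1 N e I xbar = ereal b"
      by (cases "norm1 N e I xbar") (auto simp: f_def)
    \<comment> \<open>The coordinates of the negative gradient of the quadratic term at \<open>xbar\<close>.\<close>
    define w where "w = y - A xbar"
    define \<eta> where "\<eta> k = w \<bullet> A (e k)" for k
    have fermat: "two_slope (p k) (m k) (xbar \<bullet> e k) + \<eta> k * t - 1 / 2 * (norm (A (e k)))\<^sup>2 * t\<^sup>2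
        \<le> two_slope (p k) (m k) (xbar \<bullet> e k + t)" if k: "k \<in> N" for k t
    proof -
      define x where "x = xbar + t *\<^sub>R e k"
      define D where "D = two_slope (p k) (m k) (x \<bullet> e k) - two_slope (p k) (m k) (xbar \<bullet> e k)"
      have "norm1 N e I x \<le> norm1 N e I xbar + ereal D"
        unfolding D_def using k orth
        by (intro norm1_single_coordinate_change h pm) (auto simp: x_def inner_add_left)
      then have "f x \<le> ereal (b + D) + ereal (1 / 2 * (norm (A x - y))\<^sup>2)"
        unfolding f_def b by (intro add_right_mono) simp
      from order_trans[OF le this] have "ereal (b + 1 / 2 * (norm (A xbar - y))\<^sup>2)
          \<le> ereal (b + D + 1 / 2 * (norm (A x - y))\<^sup>2)"
        by (simp add: f_def b)
      then have "1 / 2 * (norm (A xbar - y))\<^sup>2 \<le> D + 1 / 2 * (norm (A x - y))\<^sup>2"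
        by simp
      moreover have "A xbar - y = - w" "A x - y = t *\<^sub>R A (e k) - w"
        by (simp_all add: w_def x_def A.add A.scale)
      moreover have "(norm (t *\<^sub>R A (e k) - w))\<^sup>2
          = t\<^sup>2 * (norm (A (e k)))\<^sup>2 - 2 * (\<eta> k * t) + (norm w)\<^sup>2"
        unfolding power2_norm_eq_inner \<eta>_def
        by (simp add: inner_diff_left inner_diff_right inner_commute algebra_simps power2_eq_square)
      moreover have "x \<bullet> e k = xbar \<bullet> e k + t"
        using orth[OF k k] by (simp add: x_def inner_add_left)
      ultimately show ?thesis by (simp add: D_def algebra_simps)
    qed
    have stat: "two_slope (p k) (m k) (xbar \<bullet> e k) = \<eta> k * (xbar \<bullet> e k)"
        "\<eta> k \<le> p k" "- \<eta> k \<le> m k" if "k \<in> N" for k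
      using two_slope_stationary[OF pm[OF that] fermat[OF that]] by auto
    \<comment> \<open>Outside of \<open>H\<close> the coefficient lies strictly between the slopes, so \<open>xbar\<close> vanishes there.\<close>
    define H where "H = {k \<in> N. \<omega> \<le> \<bar>\<eta> k\<bar>}"
    define K where "K = J \<union> H"
    have "finite H"
      unfolding H_def \<eta>_def using orth assms(4,6) by (rule finite_large_dual_coefficients)
    then have K: "finite K" "K \<subseteq> N" using J by (auto simp: K_def H_def)
    have "xbar \<bullet> e k = 0" if k: "k \<in> N" "k \<notin> H" for k
    proof (rule ccontr)
      assume "xbar \<bullet> e k \<noteq> 0"
      moreover have "\<eta> k < p k" "- \<eta> k < m k"
        using k \<omega>pm[of k] by (auto simp: H_def abs_less_iff not_le)
      ultimately have "0 < two_slope (p k - \<eta> k) (m k + \<eta> k) (xbar \<bullet> e k)"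
        by (auto simp: two_slope_def max_def mult_pos_neg)
      then show False using stat(1)[OF k(1)] by (simp add: two_slope_tilt)
    qed
    then have "xbar \<in> supp_subspace N e K"
      by (auto simp: supp_subspace_def supp_def K_def)
    then have xbarV: "xbar \<in> span (e ` K)"
      using mem_supp_subspace_iff_span[OF assms(3) K] by simp
    \<comment> \<open>The linear part of the quadratic term at \<open>xbar\<close> is absorbed into the slopes.\<close>
    define g where "g = excess K e (\<lambda>k. p k - \<eta> k) (\<lambda>k. m k + \<eta> k) A xbar"
    have f_eq: "f x = ereal (c + g x)" if x: "x \<in> span (e ` K)" for x
    proof -
      have norm1: "norm1 N e I x = ereal (\<Sum>k\<in>K. two_slope (p k) (m k) (x \<bullet> e k))"
        if "x \<in> span (e ` K)" for x
        using that mem_supp_subspace_iff_span[OF assms(3) K] by (intro norm1_finite_support h K) auto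
      have "x - xbar \<in> span (e ` K)" using x xbarV by (rule span_diff)
      then have exp: "x - xbar = (\<Sum>k\<in>K. ((x - xbar) \<bullet> e k) *\<^sub>R e k)"
        using orthonormal_expansion[of K e] orth K by (meson subset_iff)
      have "w \<bullet> A (x - xbar) = (\<Sum>k\<in>K. ((x - xbar) \<bullet> e k) * \<eta> k)"
        by (subst exp) (simp add: A.sum A.scale inner_sum_right \<eta>_def)
      also have "\<dots> = (\<Sum>k\<in>K. \<eta> k * (x \<bullet> e k)) - (\<Sum>k\<in>K. \<eta> k * (xbar \<bullet> e k))"
        by (simp add: inner_diff_left algebra_simps flip: sum_subtractf)
      also have "(\<Sum>k\<in>K. \<eta> k * (xbar \<bullet> e k)) = (\<Sum>k\<in>K. two_slope (p k) (m k) (xbar \<bullet> e k))"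
        using stat(1) K by (intro sum.cong) auto
      finally have lin: "w \<bullet> A (x - xbar) = (\<Sum>k\<in>K. \<eta> k * (x \<bullet> e k))
          - (\<Sum>k\<in>K. two_slope (p k) (m k) (xbar \<bullet> e k))" .
      have "A x - y = A (x - xbar) - w" "A xbar - y = - w" by (simp_all add: w_def A.diff)
      then have "1 / 2 * (norm (A x - y))\<^sup>2
          = 1 / 2 * (norm (A (x - xbar)))\<^sup>2 - w \<bullet> A (x - xbar) + 1 / 2 * (norm (A xbar - y))\<^sup>2"
        by (simp add: power2_norm_eq_inner inner_diff_left inner_diff_right inner_commute)
      moreover have "c = (\<Sum>k\<in>K. two_slope (p k) (m k) (xbar \<bullet> e k)) + 1 / 2 * (norm (A xbar - y))\<^sup>2"
        using c norm1[OF xbarV] by (simp add: f_def)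
      moreover have "g x = (\<Sum>k\<in>K. two_slope (p k) (m k) (x \<bullet> e k)) - (\<Sum>k\<in>K. \<eta> k * (x \<bullet> e k))
          + 1 / 2 * (norm (A (x - xbar)))\<^sup>2"
        by (simp add: g_def excess_def two_slope_tilt sum_subtractf)
      ultimately show ?thesis
        using norm1[OF x] lin by (simp add: f_def)
    qed
    have g0: "g xbar = 0" using f_eq[OF xbarV] c by simp
    define S where "S = {z \<in> span (e ` K). g z = 0}"
    have S: "S \<subseteq> argmin f"
      using f_eq min c by (auto simp: S_def argmin_def)
    have "xbar \<in> S" using xbarV g0 by (simp add: S_def)
    obtain \<gamma> where \<gamma>: "0 < \<gamma>" "\<And>x. x \<in> span (e ` K) \<Longrightarrow> x \<in> cball xbar \<delta> \<Longrightarrow> \<gamma> * (infdist x S)\<^sup>2 \<le> g x"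
    proof -
      have "\<exists>\<gamma>>0. \<forall>x\<in>span (e ` K) \<inter> cball xbar \<delta>. \<gamma> * (infdist x S)\<^sup>2 \<le> g x"
        unfolding g_def S_def
      proof (rule excess_growth[OF K(1) _ assms(4)])
        show "excess K e (\<lambda>k. p k - \<eta> k) (\<lambda>k. m k + \<eta> k) A xbar xbar = 0"
          using g0 by (simp add: g_def)
        show "0 \<le> p k - \<eta> k" "0 \<le> m k + \<eta> k" if "k \<in> K" for k
          using stat(2,3)[of k] K that by force+
        show "e j \<bullet> e k = (if j = k then 1 else 0)" if "j \<in> K" "k \<in> K" for j k
          using orth that K by blast
      qed (rule xbarV)
      then show ?thesis using that by auto
    qed
    \<comment> \<open>Conditioning of order \<open>2\<close> divides its constant by \<open>2\<close>, hence \<open>2 * \<gamma>\<close>. The distance to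
      all minimizers is at most the distance to those in \<open>S\<close>.\<close>
    have "ereal (2 * \<gamma> / 2) * dist_powr x (argmin f) 2 \<le> f x - (INF z. f z)"
      if x: "x \<in> supp_subspace N e J \<inter> cball xbar \<delta> \<inter> sublevel f r" for x
    proof -
      have "x \<in> supp_subspace N e K" using x by (auto simp: supp_subspace_def K_def)
      then have xV: "x \<in> span (e ` K)" using mem_supp_subspace_iff_span[OF assms(3) K] by simp
      have "(infdist x (argmin f))\<^sup>2 \<le> (infdist x S)\<^sup>2"
        using S \<open>xbar \<in> S\<close> by (intro power_mono infdist_mono infdist_nonneg) auto
      then have "\<gamma> * (infdist x (argmin f))\<^sup>2 \<le> g x"
        using \<gamma>(2)[OF xV] x mult_left_mono[OF _ less_imp_le[OF \<gamma>(1)]] by (blast intro: order_trans)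
      moreover have "f x - (INF z. f z) = ereal (g x)"
        using f_eq[OF xV] c by (simp flip: min)
      moreover have "dist_powr x (argmin f) 2 = ereal ((infdist x (argmin f))\<^sup>2)"
        using xbar by (auto simp: dist_powr_def powr_numeral infdist_nonneg)
      ultimately show ?thesis by simp
    qed
    then show ?thesis
      unfolding p_conditioned_on_def using pcl \<gamma>(1) by (intro conjI exI[of _ "2 * \<gamma>"]) auto
  qed
  then have "finite_uniform_conditioning N e 2 f"
    using pcl by (simp add: finite_uniform_conditioning_def)
  then show ?thesis
    by (simp add: f_def[abs_def])
qed

end
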